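(* Let $\mathbf{S}=\{\mathbf{s}_j=(x'_j,y'_j)\mid j=1,\dots,N_S\}$ and $\mathbf{T}=\{\mathbf{t}_l=(x_l,y_l)\mid l=1,\dots,N_T\}$ denote collections of sources and targets in the unit cell $\mathcal{C}$, and let $\mathbf{P}_1^{west},\mathbf{P}_2^{west}$ denote the $N_T\times N_S$ operators with $\mathbf{P}_1^{west}(l,j)=K_1^{west}(\mathbf{t}_l,\mathbf{s}_j)$ and $\mathbf{P}_2^{west}(l,j)=K_2^{west}(\mathbf{t}_l,\mathbf{s}_j)$. Given a precision $\epsilon$, let $N_q^1=N_q^1(\beta,d,\eta)$ and $N_q^2=N_q^2(\beta,d,\eta)$ denote the number of points needed in the numerical quadrature for $K_1^{west}(\mathbf{t},\mathbf{s})$ and $K_2^{west}(\mathbf{t},\mathbf{s})$, with weights and nodes $\{w_{n,1},\lambda_{n,1}\}$ and $\{w_{n,2},\lambda_{n,2}\}$, respectively. Let $\mathbf{L}_1^{west}\in\mathbb{C}^{N_T\times N_q^1}$, $\mathbf{L}_2^{west}\in\mathbb{C}^{N_T\times N_q^2}$, $\mathbf{R}_1^{west}\in\mathbb{C}^{N_q^1\times N_S}$, $\mathbf{R}_2^{west}\in\mathbb{C}^{N_q^2\times N_S}$ be dense matrices and let $\mathbf{D}_1^{e/w}$, $\mathbf{D}_2^{west}$ be diagonal matrices of dimension $N_q^1$ and $N_q^2$, respectively, with $$\mathbf{L}_1^{west}(l,n)=e^{-\sqrt{\lambda_{n,1}^2+\beta^2}\,x_l}e^{i\lambda_{n,1}y_l},\qquad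 \mathbf{L}_2^{west}(l,n)=e^{-\sqrt{\lambda_{n,2}^2+\beta^2}\,x_l}e^{i\lambda_{n,2}y_l},$$ $$\mathbf{R}_1^{west}(n,j)=e^{\sqrt{\lambda_{n,1}^2+\beta^2}\,x'_j}e^{-i\lambda_{n,1}y'_j},\qquad \mathbf{R}_2^{west}(n,j)=e^{\sqrt{\lambda_{n,2}^2+\beta^2}\,x'_j}e^{-i\lambda_{n,2}y'_j},$$ $$\mathbf{D}_1^{e/w}(n,n)=\frac{1}{2\pi}\frac{w_{n,1}}{\sqrt{\lambda_{n,1}^2+\beta^2}}\,\frac{e^{-2\sqrt{\lambda_{n,1}^2+\beta^2}\,d}}{1-e^{-\sqrt{\lambda_{n,1}^2+\beta^2}\,d}},$$ $$\mathbf{D}_2^{west}(n,n)=\frac{w_{n,2}}{\sqrt{\lambda_{n,2}^2+\beta^2}}\,\frac{e^{-4\sqrt{\lambda_{n,2}^2+\beta^2}\,d}}{1-e^{-\sqrt{\lambda_{n,2}^2+\beta^2}\,d}}\,\frac{\left[e^{-\sqrt{\lambda_{n,2}^2+\beta^2}\,\xi+i\lambda_{n,2}\eta}+e^{\sqrt{\lambda_{n,2}^2+\beta^2}\,\xi-i\lambda_{n,2}\eta}+1\right]}{2\pi}.$$ Let $$\mathbf{P}_1^{west}=\mathbf{L}_1^{west}\,\mathbf{D}_1^{e/w}\,\mathbf{R}_1^{west},\qquad \mathbf{P}_2^{west}=\mathbf{L}_2^{west}\,\mathbf{D}_2^{west}\,\mathbf{R}_2^{west}.$$ Then the real parts of the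 vectors $\mathbf{P}_1^{west}\mathbf{q}$, $\mathbf{P}_2^{west}\mathbf{q}$ denote the contributions from the west sources to the corresponding periodizing potentials.
   Context: Setting: the two-dimensional modified Helmholtz equation, $\beta>0$, with $G(\mathbf{t},\mathbf{s})=\frac{1}{2\pi}K_0(\beta\|\mathbf{t}-\mathbf{s}\|)$, $K_0$ the modified Bessel function of the second kind of order zero. $\mathbf{q}=(q_1,\dots,q_{N_S})$ is the vector of charge strengths at the sources. The subscript 1 refers to the singly periodic problem (period in the $x$-direction) and the subscript 2 to the doubly periodic problem. Unit cell: in the singly periodic case $\mathcal{C}$ is a rectangle of dimension $d\times\eta$ centered at the origin, with period vector $\mathbf{e}_1=(d,0)$. In the doubly periodic case $\mathcal{C}=\{x_1\mathbf{e}_1+x_2\mathbf{e}_2\mid x_1,x_2\in[-\frac12,\frac12]\}$ with $\mathbf{e}_1=(d,0)$, $\mathbf{e}_2=(\xi,\eta)$, $d,\eta>0$, $d\ge\sqrt{\xi^2+\eta^2}$. Write $\mathbf{l}_{mn}=m\mathbf{e}_1+n\mathbf{e}_2$. West kernels: $K_1^{west}(\mathbf{t},\mathbf{s})=\sum_{m=-\infty}^{-2}G(\mathbf{t},\mathbf{s}+(md,0))$ and $K_2^{west}(\mathbf{t},\mathbf{s})=\sum_{n=-1}^{1}\sum_{m=-\infty}^{-4}G(\mathbf{t},\mathbf{s}+\mathbf{l}_{mn})$. Periodizing potentials: the vectors with $l$-th entry $\sum_j K_k^{far}(\mathbf{t}_l,\mathbf{s}_j)q_j$, $k=1,2$, where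 $K_1^{far}(\mathbf{t},\mathbf{s})=\sum_{|m|\ge2}G(\mathbf{t},\mathbf{s}+(md,0))$ and $K_2^{far}(\mathbf{t},\mathbf{s})=\sum G(\mathbf{t},\mathbf{s}+\mathbf{l}_{mn})$, the latter sum being over all $(m,n)\in\mathbb{Z}^2$ except those with $|m|\le3$ and $|n|\le1$. The west sources are the images appearing in $K_k^{west}$. Numerical quadrature: the nodes and weights are those of a quadrature used to discretize, to precision $\epsilon$, the integrals over $[0,\infty)$ in the following representations, with $\mathbf{t}=(x,y)$, $\mathbf{s}=(x',y')$ and $\sigma(\lambda)=\sqrt{\lambda^2+\beta^2}$: $$K_1^{west}(\mathbf{t},\mathbf{s})=\operatorname{Re}\int_0^\infty F_1(\lambda)\,d\lambda\approx\operatorname{Re}\sum_{n=1}^{N_q^1}w_{n,1}F_1(\lambda_{n,1}),\qquad F_1(\lambda)=\frac{e^{-\sigma(x-x')}}{2\pi\sigma}e^{i\lambda(y-y')}\frac{e^{-2\sigma d}}{1-e^{-\sigma d}},$$ $$K_2^{west}(\mathbf{t},\mathbf{s})=\operatorname{Re}\int_0^\infty F_2(\lambda)\,d\lambda\approx\operatorname{Re}\sum_{n=1}^{N_q^2}w_{n,2}F_2(\lambda_{n,2}),\qquad F_2(\lambda)=\frac{e^{-\sigma(x-x')}}{2\pi\sigma}e^{i\lambda(y-y')}\frac{e^{-4\sigma d}}{1-e^{-\sigma d}}\left[e^{-\sigma\xi+i\lambda\eta}+e^{\sigma\xi-i\lambda\eta}+1\right].$$ As in the source, the symbols $\mathbf{P}_1^{west},\mathbf{P}_2^{west}$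 are used first for the exact operators and then for their discretized factorizations; the conclusion concerns the factorizations. *)

theory Defs
  imports "HOL-Analysis.Analysis" "Jordan_Normal_Form.Matrix"
begin

unbundle no vec_syntax
hide_const (open) Finite_Cartesian_Product.vec Finite_Cartesian_Product.mat

type_synonym point = "real \<times> real"

text \<open>The modified Bessel function of the second kind of order zero at a positive real argument,
  by its classical integral representation.\<close>

definition bessel_K0 :: "real \<Rightarrow> real" where
  "bessel_K0 z = (LINT u:{0..}|lborel. exp (- z * cosh u))"

text \<open>The norm on \<^typ>\<open>real \<times> real\<close> is the Euclidean one.\<close>

definition G :: "real \<Rightarrow> point \<Rightarrow> point \<Rightarrow> real" where
  "G \<beta> t s = bessel_K0 (\<beta> * norm (t - s)) / (2 * pi)"

definition period :: "real \<Rightarrow> int \<Rightarrow> point" where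
  "period d m = (of_int m * d, 0)"

definition lattice :: "real \<Rightarrow> real \<Rightarrow> real \<Rightarrow> int \<Rightarrow> int \<Rightarrow> point" where
  "lattice d \<xi> \<eta> m n = of_int m *\<^sub>R (d, 0) + of_int n *\<^sub>R (\<xi>, \<eta>)"

definition cell1 :: "real \<Rightarrow> real \<Rightarrow> point set" where
  "cell1 d \<eta> = {- d / 2 .. d / 2} \<times> {- \<eta> / 2 .. \<eta> / 2}"

definition cell2 :: "real \<Rightarrow> real \<Rightarrow> real \<Rightarrow> point set" where
  "cell2 d \<xi> \<eta> =
     {x1 *\<^sub>R (d, 0) + x2 *\<^sub>R (\<xi>, \<eta>) | x1 x2. x1 \<in> {- 1 / 2 .. 1 / 2} \<and> x2 \<in> {- 1 / 2 .. 1 / 2}}"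

definition west1 :: "int set" where "west1 = {..-2}"
definition far1 :: "int set" where "far1 = {m. \<bar>m\<bar> \<ge> 2}"

definition west2 :: "(int \<times> int) set" where "west2 = {..-4} \<times> {-1..1}"
definition far2 :: "(int \<times> int) set" where "far2 = {(m, n). \<not> (\<bar>m\<bar> \<le> 3 \<and> \<bar>n\<bar> \<le> 1)}"

definition K1_images :: "int set \<Rightarrow> real \<Rightarrow> real \<Rightarrow> point \<Rightarrow> point \<Rightarrow> real" where
  "K1_images I \<beta> d t s = (\<Sum>\<^sub>\<infinity>m\<in>I. G \<beta> t (s + period d m))"

definition K2_images ::
    "(int \<times> int) set \<Rightarrow> real \<Rightarrow> real \<Rightarrow> real \<Rightarrow> real \<Rightarrow> point \<Rightarrow> point \<Rightarrow> real" where
  "K2_images I \<beta> d \<xi> \<eta> t s = (\<Sum>\<^sub>\<infinity>(m, n)\<in>I. G \<beta> t (s + lattice d \<xi> \<eta> m n))"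

definition K1_west :: "real \<Rightarrow> real \<Rightarrow> point \<Rightarrow> point \<Rightarrow> real" where
  "K1_west \<beta> d t s = (\<Sum>\<^sub>\<infinity>m\<in>{..-2}. G \<beta> t (s + period d m))"

definition K2_west :: "real \<Rightarrow> real \<Rightarrow> real \<Rightarrow> real \<Rightarrow> point \<Rightarrow> point \<Rightarrow> real" where
  "K2_west \<beta> d \<xi> \<eta> t s = (\<Sum>n\<in>{-1..1}. \<Sum>\<^sub>\<infinity>m\<in>{..-4}. G \<beta> t (s + lattice d \<xi> \<eta> m n))"

definition \<sigma> :: "real \<Rightarrow> real \<Rightarrow> real" where
  "\<sigma> \<beta> \<mu> = sqrt (\<mu>\<^sup>2 + \<beta>\<^sup>2)"

definition F1 :: "real \<Rightarrow> real \<Rightarrow> point \<Rightarrow> point \<Rightarrow> real \<Rightarrow> complex" where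
  "F1 \<beta> d t s \<mu> =
     of_real (exp (- \<sigma> \<beta> \<mu> * (fst t - fst s)) / (2 * pi * \<sigma> \<beta> \<mu>))
     * exp (\<i> * of_real (\<mu> * (snd t - snd s)))
     * of_real (exp (- 2 * \<sigma> \<beta> \<mu> * d) / (1 - exp (- \<sigma> \<beta> \<mu> * d)))"

definition F2 :: "real \<Rightarrow> real \<Rightarrow> real \<Rightarrow> real \<Rightarrow> point \<Rightarrow> point \<Rightarrow> real \<Rightarrow> complex" where
  "F2 \<beta> d \<xi> \<eta> t s \<mu> =
     of_real (exp (- \<sigma> \<beta> \<mu> * (fst t - fst s)) / (2 * pi * \<sigma> \<beta> \<mu>))
     * exp (\<i> * of_real (\<mu> * (snd t - snd s)))
     * of_real (exp (- 4 * \<sigma> \<beta> \<mu> * d) / (1 - exp (- \<sigma> \<beta> \<mu> * d)))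
     * (exp (of_real (- \<sigma> \<beta> \<mu> * \<xi>) + \<i> * of_real (\<mu> * \<eta>))
        + exp (of_real (\<sigma> \<beta> \<mu> * \<xi>) - \<i> * of_real (\<mu> * \<eta>)) + 1)"

text \<open>The nodes and weights do not depend on the points; the absolute error bound \<open>\<epsilon>\<close> is uniform
  over all pairs of points in the unit cell \<open>C\<close>.\<close>

definition quadrature ::
    "real \<Rightarrow> point set \<Rightarrow> (point \<Rightarrow> point \<Rightarrow> real \<Rightarrow> complex) \<Rightarrow> nat \<Rightarrow> (nat \<Rightarrow> real) \<Rightarrow> (nat \<Rightarrow> real) \<Rightarrow> bool"
  where
  "quadrature \<epsilon> C F N w lam \<longleftrightarrow>
     (\<forall>n<N. 0 \<le> lam n) \<and>
     (\<forall>t\<in>C. \<forall>s\<in>C.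
        \<bar>Re (LINT \<mu>:{0..}|lborel. F t s \<mu>) - Re (\<Sum>n<N. of_real (w n) * F t s (lam n))\<bar> \<le> \<epsilon>)"

text \<open>All indices start at 0: sources are \<open>s 0, \<dots>, s (NS - 1)\<close>, and similarly for targets and
  quadrature nodes.\<close>

definition kernel_matrix ::
    "(point \<Rightarrow> point \<Rightarrow> real) \<Rightarrow> nat \<Rightarrow> nat \<Rightarrow> (nat \<Rightarrow> point) \<Rightarrow> (nat \<Rightarrow> point) \<Rightarrow> real mat" where
  "kernel_matrix K NT NS t s = Matrix.mat NT NS (\<lambda>(l, j). K (t l) (s j))"

text \<open>The singly and doubly periodic problems have the same formulas for the entries of the
  left and right factors, at their respective nodes.\<close>

definition L_west :: "real \<Rightarrow> nat \<Rightarrow> nat \<Rightarrow> (nat \<Rightarrow> real) \<Rightarrow> (nat \<Rightarrow> point) \<Rightarrow> complex mat" where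
  "L_west \<beta> NT N lam t = Matrix.mat NT N (\<lambda>(l, n).
     exp (of_real (- sqrt ((lam n)\<^sup>2 + \<beta>\<^sup>2) * fst (t l))) * exp (\<i> * of_real (lam n * snd (t l))))"

definition R_west :: "real \<Rightarrow> nat \<Rightarrow> nat \<Rightarrow> (nat \<Rightarrow> real) \<Rightarrow> (nat \<Rightarrow> point) \<Rightarrow> complex mat" where
  "R_west \<beta> N NS lam s = Matrix.mat N NS (\<lambda>(n, j).
     exp (of_real (sqrt ((lam n)\<^sup>2 + \<beta>\<^sup>2) * fst (s j))) * exp (- \<i> * of_real (lam n * snd (s j))))"

definition D1_ew :: "real \<Rightarrow> real \<Rightarrow> nat \<Rightarrow> (nat \<Rightarrow> real) \<Rightarrow> (nat \<Rightarrow> real) \<Rightarrow> complex mat" where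
  "D1_ew \<beta> d N w lam = mat_diag N (\<lambda>n. of_real (
     1 / (2 * pi) * (w n / sqrt ((lam n)\<^sup>2 + \<beta>\<^sup>2))
     * (exp (- 2 * sqrt ((lam n)\<^sup>2 + \<beta>\<^sup>2) * d) / (1 - exp (- sqrt ((lam n)\<^sup>2 + \<beta>\<^sup>2) * d)))))"

definition D2_west ::
    "real \<Rightarrow> real \<Rightarrow> real \<Rightarrow> real \<Rightarrow> nat \<Rightarrow> (nat \<Rightarrow> real) \<Rightarrow> (nat \<Rightarrow> real) \<Rightarrow> complex mat" where
  "D2_west \<beta> d \<xi> \<eta> N w lam = mat_diag N (\<lambda>n.
     of_real (w n / sqrt ((lam n)\<^sup>2 + \<beta>\<^sup>2)
       * (exp (- 4 * sqrt ((lam n)\<^sup>2 + \<beta>\<^sup>2) * d) / (1 - exp (- sqrt ((lam n)\<^sup>2 + \<beta>\<^sup>2) * d))))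
     * ((exp (of_real (- sqrt ((lam n)\<^sup>2 + \<beta>\<^sup>2) * \<xi>) + \<i> * of_real (lam n * \<eta>))
         + exp (of_real (sqrt ((lam n)\<^sup>2 + \<beta>\<^sup>2) * \<xi>) - \<i> * of_real (lam n * \<eta>)) + 1)
        / of_real (2 * pi)))"

definition P1_west ::
    "real \<Rightarrow> real \<Rightarrow> nat \<Rightarrow> nat \<Rightarrow> nat \<Rightarrow> (nat \<Rightarrow> real) \<Rightarrow> (nat \<Rightarrow> real)
     \<Rightarrow> (nat \<Rightarrow> point) \<Rightarrow> (nat \<Rightarrow> point) \<Rightarrow> complex mat" where
  "P1_west \<beta> d NT NS N w lam t s =
     L_west \<beta> NT N lam t * D1_ew \<beta> d N w lam * R_west \<beta> N NS lam s"

definition P2_west ::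
    "real \<Rightarrow> real \<Rightarrow> real \<Rightarrow> real \<Rightarrow> nat \<Rightarrow> nat \<Rightarrow> nat \<Rightarrow> (nat \<Rightarrow> real) \<Rightarrow> (nat \<Rightarrow> real)
     \<Rightarrow> (nat \<Rightarrow> point) \<Rightarrow> (nat \<Rightarrow> point) \<Rightarrow> complex mat" where
  "P2_west \<beta> d \<xi> \<eta> NT NS N w lam t s =
     L_west \<beta> NT N lam t * D2_west \<beta> d \<xi> \<eta> N w lam * R_west \<beta> N NS lam s"

definition re_apply :: "complex mat \<Rightarrow> real Matrix.vec \<Rightarrow> real Matrix.vec" where
  "re_apply P q = map_vec Re (P *\<^sub>v map_vec complex_of_real q)"

end

theory Submission
  imports Defs "HOL-Complex_Analysis.Cauchy_Integral_Theorem"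
begin

text \<open>To the east of its source, the potential has the plane wave representation
  \<open>K\<^sub>0 (\<beta> \<surd>(x\<^sup>2 + y\<^sup>2)) = Re \<integral>\<^sub>0\<^sup>\<infinity> e\<^bsup>-\<sigma> x\<^esup> e\<^bsup>i \<mu> y\<^esup> / \<sigma> d\<mu>\<close> for \<open>x > 0\<close>, obtained by a contour shift.
  Moving the source one period further west multiplies the integrand by \<open>e\<^bsup>-\<sigma> d\<^esup>\<close>, so that summing a
  row of images is a geometric series under the integral, which yields \<open>F1\<close> and, with three rows,
  \<open>F2\<close>. The dependence of the integrand on target and source separates at every node, which is the
  factorization, and the quadrature error is then weighted by the charges. The lattice sums converge because
  \<open>K\<^sub>0\<close> decays exponentially.\<close>

section \<open>Exponential comparison and decay of the Bessel function\<close>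

lemma set_integrable_exp_minus:
  fixes a c :: real
  assumes "a > 0"
  shows "set_integrable lborel {c..} (\<lambda>x. exp (- a * x))"
proof -
  have "(\<lambda>x. exp (- a * x)) absolutely_integrable_on {c..}"
    by (intro nonnegative_absolutely_integrable_1 integrable_on_exp_minus_to_infinity assms) auto
  \<comment> \<open>Absolute integrability refers to the completed measure \<open>lebesgue\<close>;
    the integrand is Borel measurable, so it descends to \<open>lborel\<close>.\<close>
  then show ?thesis
    unfolding set_integrable_def
    by (subst (asm) integrable_completion) auto
qed

text \<open>Comparison test shared by the Bessel integral and the plane wave integral. Continuity
  supplies the Borel measurability.\<close>

lemma set_integrable_exp_minus_bound:
  fixes f :: "real \<Rightarrow> 'a :: {banach, second_countable_topology}"
  assumes "a > 0" and "continuous_on {c..} f"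
    and "\<And>u. u \<ge> c \<Longrightarrow> norm (f u) \<le> B * exp (- a * u)"
  shows "set_integrable lborel {c..} f"
proof (rule set_integrable_bound)
  show "set_integrable lborel {c..} (\<lambda>u. B * exp (- a * u))"
    using set_integrable_exp_minus[OF assms(1)] by simp
  show "set_borel_measurable lborel {c..} f"
    unfolding set_borel_measurable_def
    using borel_measurable_continuous_on_indicator[OF _ assms(2)] by simp
  show "AE x in lborel. x \<in> {c..} \<longrightarrow> norm (f x) \<le> norm (B * exp (- a * x))"
    using assms(3) by (intro AE_I2) (force intro: order_trans[OF _ abs_ge_self])
qed

text \<open>A linear minorant suffices to dominate \<open>exp (- z * cosh u)\<close> by an
  exponential. For \<open>u >= 0\<close>, the square of \<open>u - 1\<close> and the quadratic
  Taylor bound give \<open>2 * u <= exp u\<close>.\<close>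

lemma le_cosh_real: "u \<le> cosh (u :: real)"
proof (cases "u \<ge> 0")
  case True
  have "u * 2 \<le> 1 + u * u"
    using zero_le_square[of "u - 1"] by (simp add: algebra_simps)
  moreover have "1 + u + u * u / 2 \<le> exp u"
    using exp_lower_Taylor_quadratic[OF True] by (simp add: power2_eq_square)
  ultimately have "u * 2 \<le> exp u + exp (- u)"
    using exp_gt_zero[of "- u"] by linarith
  then show ?thesis
    by (simp add: cosh_def)
next
  case False
  then show ?thesis using cosh_real_ge_1[of u] by linarith
qed

lemma bessel_K0_set_integrable:
  fixes z :: real
  assumes "z > 0"
  shows "set_integrable lborel {0..} (\<lambda>u. exp (- z * cosh u))"
proof (rule set_integrable_exp_minus_bound[where a = z and B = 1])
  fix u :: real
  show "norm (exp (- z * cosh u)) \<le> 1 * exp (- z * u)"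
    using le_cosh_real[of u] assms by simp
qed (use assms in \<open>auto intro!: continuous_intros\<close>)

lemma bessel_K0_nonneg: "bessel_K0 z \<ge> 0"
  unfolding bessel_K0_def unfolding set_lebesgue_integral_def by (rule Bochner_Integration.integral_nonneg) (auto simp: indicator_def)

text \<open>The exponent is split in halves: \<open>cosh u >= 1\<close> gives the decay in
  \<open>z\<close>, while \<open>z >= 1\<close> and \<open>cosh u >= u\<close> give an integrable
  decay in \<open>u\<close>. The factor 2 is the integral of \<open>exp (- u / 2)\<close>. This
  crude rate is enough for the lattice sums.\<close>

lemma bessel_K0_le:
  assumes "z \<ge> 1"
  shows "bessel_K0 z \<le> 2 * exp (- z / 2)"
proof -
  have eq: "(LINT u:{0..}|lborel. exp (- z / 2) * exp (- (1/2) * u)) = 2 * exp (- z / 2)"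
    using set_borel_integral_eq_integral(2)[OF set_integrable_exp_minus[of "1/2" 0]]
      has_integral_exp_minus_to_infinity[of "1/2" 0]
    by (simp add: integral_unique)
  have "bessel_K0 z \<le> (LINT u:{0..}|lborel. exp (- z / 2) * exp (- (1/2) * u))"
    unfolding bessel_K0_def
  proof (rule set_integral_mono)
    show "set_integrable lborel {0..} (\<lambda>u. exp (- z * cosh u))"
      using assms by (intro bessel_K0_set_integrable) auto
    show "set_integrable lborel {0..} (\<lambda>u. exp (- z / 2) * exp (- (1/2) * u))"
      using set_integrable_exp_minus[of "1/2" 0] by simp
    fix u :: real
    have "z * 1 \<le> z * cosh u" "1 * cosh u \<le> z * cosh u"
      using assms cosh_real_ge_1[of u] by (auto intro!: mult_left_mono mult_right_mono)
    then have "z / 2 + u / 2 \<le> z * cosh u"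
      using le_cosh_real[of u] by linarith
    then show "exp (- z * cosh u) \<le> exp (- z / 2) * exp (- (1/2) * u)"
      by (simp add: exp_add [symmetric])
  qed
  then show ?thesis using eq by simp
qed

section \<open>Plane waves\<close>

text \<open>The mode exp(-\<sigma> x + i \<mu> y) solves the modified Helmholtz equation because
  \<sigma>^2 - \<mu>^2 = \<beta>^2. The weight 1/\<sigma> is the derivative of
  arsinh(\<mu>/\<beta>), hence the Jacobian of the substitution made below.\<close>

definition plane_wave :: "real \<Rightarrow> real \<Rightarrow> real \<Rightarrow> real \<Rightarrow> complex" where
  "plane_wave \<beta> x y \<mu> = of_real (exp (- \<sigma> \<beta> \<mu> * x) / \<sigma> \<beta> \<mu>) * exp (\<i> * of_real (\<mu> * y))"

lemma sigma_pos: "\<beta> > 0 \<Longrightarrow> \<sigma> \<beta> \<mu> > 0"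
  unfolding \<sigma>_def by (simp add: add_nonneg_pos)

lemma sigma_ge: "\<beta> > 0 \<Longrightarrow> \<sigma> \<beta> \<mu> \<ge> \<beta>"
  unfolding \<sigma>_def by (rule real_le_rsqrt) simp

lemma sigma_ge_abs: "\<sigma> \<beta> \<mu> \<ge> \<bar>\<mu>\<bar>"
  unfolding \<sigma>_def by (rule real_le_rsqrt) simp

lemma norm_plane_wave:
  "\<beta> > 0 \<Longrightarrow> norm (plane_wave \<beta> x y \<mu>) = exp (- \<sigma> \<beta> \<mu> * x) / \<sigma> \<beta> \<mu>"
  using sigma_pos[of \<beta> \<mu>]
  by (simp add: plane_wave_def norm_mult norm_divide del: of_real_divide)

lemma continuous_on_plane_wave: "\<beta> > 0 \<Longrightarrow> continuous_on A (plane_wave \<beta> x y)"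
  using sigma_pos[of \<beta>] unfolding plane_wave_def \<sigma>_def
  by (intro continuous_intros) (auto simp: less_imp_neq[symmetric] dest: less_imp_neq[OF _ , symmetric])

lemma set_integrable_plane_wave:
  assumes "\<beta> > 0" "x > 0"
  shows "set_integrable lborel {0..} (plane_wave \<beta> x y)"
proof (rule set_integrable_exp_minus_bound)
  show "continuous_on {0..} (plane_wave \<beta> x y)"
    by (rule continuous_on_plane_wave[OF assms(1)])
  fix \<mu> :: real assume "\<mu> \<ge> 0"
  \<comment> \<open>Two lower bounds for \<sigma> are combined: |\<mu>| in the exponent yields decay
    at rate \<open>x\<close>, and \<beta> in the denominator keeps the weight bounded.\<close>
  have "exp (- \<sigma> \<beta> \<mu> * x) / \<sigma> \<beta> \<mu> \<le> exp (- x * \<mu>) / \<beta>"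
    using sigma_ge[OF assms(1)] sigma_ge_abs[of \<mu> \<beta>] assms
    by (intro frac_le) (auto simp: mult.commute[of x])
  then show "norm (plane_wave \<beta> x y \<mu>) \<le> (1 / \<beta>) * exp (- x * \<mu>)"
    using norm_plane_wave[OF assms(1)] by simp
qed (use assms in auto)

section \<open>Contour shift from plane waves to the Bessel function\<close>

text \<open>Addition formula: cosh(u - i\<theta>) = cosh u cos \<theta> - i sinh u sin \<theta>. The
  modulus decays in \<open>u\<close> when \<open>r * cos \<theta> > 0\<close>, so a shift by an
  angle below pi/2 keeps the integrand small at infinity.\<close>

lemma exp_cosh_shifted:
  fixes r \<theta> u :: real
  shows "exp (- of_real r * cosh (of_real u - \<i> * of_real \<theta>)) =
    of_real (exp (- r * cos \<theta> * cosh u)) * exp (\<i> * of_real (r * sin \<theta> * sinh u))"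
proof -
  have c: "cosh (of_real u :: complex) = of_real (cosh u)" "sinh (of_real u :: complex) = of_real (sinh u)"
    by (simp_all add: cosh_field_def sinh_field_def exp_of_real flip: of_real_minus)
  have i: "cosh (\<i> * of_real \<theta>) = (of_real (cos \<theta>) :: complex)" "sinh (\<i> * of_real \<theta>) = \<i> * of_real (sin \<theta>)"
    by (simp_all add: cosh_conv_cos sinh_conv_sin cos_of_real sin_of_real)
  show ?thesis
    unfolding cosh_diff c i exp_of_real[symmetric] exp_add[symmetric]
    by (simp add: algebra_simps flip: of_real_mult)
qed

text \<open>With u = arsinh(\<mu>/\<beta>) one has \<beta> cosh u = \<sigma> and \<beta> sinh u =
  \<mu>, so the decay and the phase of the wave are the two factors in
  \<open>exp_cosh_shifted\<close>.\<close>

lemma plane_wave_eq_exp_cosh: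
  fixes \<beta> r \<theta> \<mu> :: real
  assumes "\<beta> > 0"
  shows "plane_wave \<beta> (r * cos \<theta>) (r * sin \<theta>) \<mu> =
    exp (- of_real (\<beta> * r) * cosh (of_real (arsinh (\<mu> / \<beta>)) - \<i> * of_real \<theta>)) * of_real (1 / \<sigma> \<beta> \<mu>)"
proof -
  have "\<beta> * cosh (arsinh (\<mu> / \<beta>)) = sqrt (\<beta>\<^sup>2 * ((\<mu> / \<beta>)\<^sup>2 + 1))"
    using assms by (simp add: cosh_arsinh_real real_sqrt_mult)
  also have "\<beta>\<^sup>2 * ((\<mu> / \<beta>)\<^sup>2 + 1) = \<mu>\<^sup>2 + \<beta>\<^sup>2"
    using assms by (simp add: field_simps)
  finally have c: "\<beta> * cosh (arsinh (\<mu> / \<beta>)) = \<sigma> \<beta> \<mu>"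
    by (simp add: \<sigma>_def)
  have e: "- (\<beta> * r) * cos \<theta> * cosh (arsinh (\<mu> / \<beta>)) = - \<sigma> \<beta> \<mu> * (r * cos \<theta>)"
    "\<beta> * r * sin \<theta> * sinh (arsinh (\<mu> / \<beta>)) = \<mu> * (r * sin \<theta>)"
    using assms by (simp_all flip: c)
  show ?thesis
    unfolding plane_wave_def exp_cosh_shifted e by simp
qed

lemma arsinh_scaled_has_derivative:
  fixes \<beta> \<mu> :: real
  assumes "\<beta> > 0"
  shows "((\<lambda>\<mu>. arsinh (\<mu> / \<beta>)) has_real_derivative 1 / \<sigma> \<beta> \<mu>) (at \<mu> within A)"
proof -
  have "\<sigma> \<beta> \<mu> = sqrt (\<beta>\<^sup>2 * ((\<mu> / \<beta>)\<^sup>2 + 1))"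
    using assms by (simp add: \<sigma>_def field_simps)
  also have "\<dots> = \<beta> * sqrt ((\<mu> / \<beta>)\<^sup>2 + 1)"
    using assms by (simp add: real_sqrt_mult)
  finally have "1 / sqrt ((\<mu> / \<beta>)\<^sup>2 + 1) * (1 / \<beta>) = 1 / \<sigma> \<beta> \<mu>"
    using assms by simp
  moreover have "((\<lambda>\<mu>. arsinh (\<mu> / \<beta>)) has_real_derivative 1 / sqrt ((\<mu> / \<beta>)\<^sup>2 + 1) * (1 / \<beta>)) (at \<mu> within A)"
    by (intro DERIV_chain2[OF arsinh_real_has_field_derivative] DERIV_cdivide DERIV_ident)
  ultimately show ?thesis by simp
qed

lemma polar_right_half_plane:
  fixes x y :: real
  assumes "x > 0"
  obtains \<theta> where "\<bar>\<theta>\<bar> < pi / 2" "x = norm (x, y) * cos \<theta>" "y = norm (x, y) * sin \<theta>"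
proof
  have "x * sqrt (1 + (y / x)\<^sup>2) = sqrt (x\<^sup>2 * (1 + (y / x)\<^sup>2))"
    using assms by (simp add: real_sqrt_mult)
  also have "\<dots> = norm (x, y)"
    using assms by (simp add: norm_Pair field_simps)
  finally have n: "norm (x, y) = x * sqrt (1 + (y / x)\<^sup>2)" ..
  have s: "sqrt (1 + (y / x)\<^sup>2) > 0" by (simp add: add_pos_nonneg)
  show "x = norm (x, y) * cos (arctan (y / x))" "y = norm (x, y) * sin (arctan (y / x))"
    unfolding n cos_arctan sin_arctan using s assms by simp_all
  show "\<bar>arctan (y / x)\<bar> < pi / 2"
    using arctan_bounded[of "y / x"] by auto
qed

text \<open>Substituting \<open>\<mu> = \<beta> sinh u\<close> turns the right-hand side into the integral of
  \<open>exp (- \<beta> r cosh w)\<close> along the horizontal line \<open>Im w = - \<theta>\<close>, where \<open>(r, \<theta>)\<close> are the polar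
  coordinates of \<open>(x, y)\<close>; shifting the contour to the real axis gives \<^const>\<open>bessel_K0\<close>. The vertical
  edge at \<open>0\<close> only contributes to the imaginary part.\<close>

lemma bessel_K0_eq_plane_wave_integral:
  fixes \<beta> x y :: real
  assumes \<beta>: "\<beta> > 0" and x: "x > 0"
  shows "bessel_K0 (\<beta> * norm (x, y)) = Re (LINT \<mu>:{0..}|lborel. plane_wave \<beta> x y \<mu>)"
proof -
  define r where "r = norm (x, y)"
  obtain \<theta> where \<theta>: "\<bar>\<theta>\<bar> < pi / 2" "x = r * cos \<theta>" "y = r * sin \<theta>"
    using polar_right_half_plane[OF x, of y] unfolding r_def by metis
  define z where "z = \<beta> * r"
  have "r > 0" using x by (simp add: r_def zero_prod_def)
  then have z: "z > 0" using \<beta> by (simp add: z_def)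
  have cos_pos: "cos \<theta> > 0" using \<theta>(1) by (intro cos_gt_zero_pi) auto
  define h :: "complex \<Rightarrow> complex" where "h w = exp (- of_real z * cosh w)" for w
  \<comment> \<open>An entire function has a global primitive \<open>H\<close>. Each edge of the
    rectangle with corners 0, U, U - i\<theta>, -i\<theta> then contributes a difference of values
    of \<open>H\<close>, and Cauchy's theorem becomes telescoping.\<close>
  have "h holomorphic_on UNIV"
    unfolding h_def cosh_field_def by (intro holomorphic_intros) auto
  then obtain H where H: "(H has_field_derivative h w) (at w)" for w
    using holomorphic_convex_primitive'[of UNIV h] by auto
  \<comment> \<open>The parametrization \<open>g\<close> is left general: it is the identity on the
    real edge and arsinh(\<mu>/\<beta>) on the shifted edge.\<close>
  have H_vec: "((\<lambda>v. H (of_real (g v) - \<i> * of_real \<phi>)) has_vector_derivative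
      h (of_real (g v) - \<i> * of_real \<phi>) * of_real g') (at v within A)"
    if "(g has_real_derivative g') (at v within A)" for g g' \<phi> v A
  proof -
    have "((\<lambda>v. of_real (g v) - \<i> * of_real \<phi>) has_vector_derivative of_real g') (at v within A)"
      using that by (auto intro!: derivative_eq_intros simp: has_real_derivative_iff_has_vector_derivative)
    from field_vector_diff_chain_within[OF this has_field_derivative_at_within[OF H]] show ?thesis
      by (simp add: o_def mult.commute)
  qed
  have h_real: "h (of_real u) = of_real (exp (- z * cosh u))" for u
    using exp_cosh_shifted[of z u 0] by (simp add: h_def)
  have int_K0: "(LINT u:{0..U}|lborel. exp (- z * cosh u)) = Re (H (of_real U) - H 0)" if "U \<ge> 0" for U
  proof -
    have "complex_of_real (LINT u:{0..U}|lborel. exp (- z * cosh u)) = (LINT u:{0..U}|lborel. h (of_real u))"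
      unfolding h_real by (rule set_integral_complex_of_real[symmetric])
    also have "\<dots> = H (of_real U) - H (of_real 0)"
      unfolding set_lebesgue_integral_def
    proof (rule integral_FTC_atLeastAtMost[OF that])
      show "((\<lambda>u. H (of_real u)) has_vector_derivative h (of_real u)) (at u within {0..U})" for u
        using H_vec[of "\<lambda>u. u" 1 u _ 0] by simp
      show "continuous_on {0..U} (\<lambda>u. h (of_real u))"
        unfolding h_real by (intro continuous_intros)
    qed
    finally show ?thesis by (metis Re_complex_of_real of_real_0)
  qed
  \<comment> \<open>The cutoff \<open>\<beta> * sinh U\<close> is the image of \<open>U\<close>
    under the substitution, so both horizontal edges end at the same real part.\<close>
  have int_pw: "Re (LINT \<mu>:{0..\<beta> * sinh U}|lborel. plane_wave \<beta> x y \<mu>) =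
      Re (H (of_real U - \<i> * of_real \<theta>) - H (- \<i> * of_real \<theta>))" if "U \<ge> 0" for U
  proof -
    let ?\<Phi> = "\<lambda>\<mu>. H (of_real (arsinh (\<mu> / \<beta>)) - \<i> * of_real \<theta>)"
    have "(LINT \<mu>:{0..\<beta> * sinh U}|lborel. plane_wave \<beta> x y \<mu>) = ?\<Phi> (\<beta> * sinh U) - ?\<Phi> 0"
      unfolding set_lebesgue_integral_def
    proof (rule integral_FTC_atLeastAtMost)
      show "0 \<le> \<beta> * sinh U" using that \<beta> by simp
      show "(?\<Phi> has_vector_derivative plane_wave \<beta> x y \<mu>) (at \<mu> within {0..\<beta> * sinh U})" for \<mu>
        unfolding \<theta>(2,3) plane_wave_eq_exp_cosh[OF \<beta>]
        using H_vec[OF arsinh_scaled_has_derivative[OF \<beta>], where v = \<mu> and \<phi> = \<theta>] unfolding h_def z_def .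
      show "continuous_on {0..\<beta> * sinh U} (plane_wave \<beta> x y)"
        by (rule continuous_on_plane_wave[OF \<beta>])
    qed
    then show ?thesis using \<beta> by (simp add: arsinh_sinh_real)
  qed
  have H_vert: "((\<lambda>\<phi>. H (of_real U - \<i> * of_real \<phi>)) has_vector_derivative
      - \<i> * h (of_real U - \<i> * of_real \<phi>)) (at \<phi> within A)" for U \<phi> A
  proof -
    have "((\<lambda>\<phi>. of_real U - \<i> * of_real \<phi>) has_vector_derivative - \<i>) (at \<phi> within A)"
      by (auto intro!: derivative_eq_intros)
    from field_vector_diff_chain_within[OF this has_field_derivative_at_within[OF H]] show ?thesis
      by (simp add: o_def)
  qed
  \<comment> \<open>On the imaginary axis cosh is a real cosine, so \<open>h\<close> is real and the
    derivative of \<open>H\<close> along the edge, \<open>- \<i> * h\<close>, is purely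
    imaginary.\<close>
  have left_edge: "Re (H (- \<i> * of_real \<theta>)) = Re (H 0)"
  proof -
    have "((\<lambda>\<phi>. Re (H (- \<i> * of_real \<phi>))) has_vector_derivative 0) (at \<phi> within UNIV)" for \<phi>
    proof -
      have "Im (h (- \<i> * of_real \<phi>)) = 0"
        using exp_cosh_shifted[of z 0 \<phi>] by (simp add: h_def)
      then show ?thesis
        using bounded_linear.has_vector_derivative[OF bounded_linear_Re H_vert[of 0 \<phi> UNIV]] by simp
    qed
    then have "(\<lambda>\<phi>. Re (H (- \<i> * of_real \<phi>))) \<theta> = (\<lambda>\<phi>. Re (H (- \<i> * of_real \<phi>))) 0"
      by (intro DERIV_isconst_all) (auto simp: has_real_derivative_iff_has_vector_derivative)
    then show ?thesis by simp
  qed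
  \<comment> \<open>Mean value inequality along the vertical edge. The symmetric range of angles
    covers both signs of \<theta>, and \<open>cos \<phi> >= cos \<theta>\<close> on it makes the
    bound uniform.\<close>
  have right_edge: "norm (H (of_real U - \<i> * of_real \<theta>) - H (of_real U)) \<le> exp (- (z * cos \<theta>) * cosh U) * \<bar>\<theta>\<bar>" for U
  proof -
    have "norm (H (of_real U - \<i> * of_real \<theta>) - H (of_real U - \<i> * of_real 0)) \<le>
        exp (- (z * cos \<theta>) * cosh U) * norm (\<theta> - 0)"
    proof (rule differentiable_bound[of "{- \<bar>\<theta>\<bar>..\<bar>\<theta>\<bar>}"])
      fix \<phi> assume \<phi>: "\<phi> \<in> {- \<bar>\<theta>\<bar>..\<bar>\<theta>\<bar>}"
      show "((\<lambda>\<phi>. H (of_real U - \<i> * of_real \<phi>)) has_derivative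
          (\<lambda>v. v *\<^sub>R (- \<i> * h (of_real U - \<i> * of_real \<phi>)))) (at \<phi> within {- \<bar>\<theta>\<bar>..\<bar>\<theta>\<bar>})"
        using H_vert unfolding has_vector_derivative_def .
      have "cos \<theta> \<le> cos \<phi>"
        using \<phi> \<theta>(1) cos_monotone_0_pi_le[of "\<bar>\<phi>\<bar>" "\<bar>\<theta>\<bar>"] by auto
      then have "z * cos \<theta> * cosh U \<le> z * cos \<phi> * cosh U"
        using z by (intro mult_right_mono mult_left_mono) auto
      moreover have "norm (h (of_real U - \<i> * of_real \<phi>)) = exp (- z * cos \<phi> * cosh U)"
        unfolding h_def exp_cosh_shifted by (simp add: norm_mult)
      ultimately show "onorm (\<lambda>v. v *\<^sub>R (- \<i> * h (of_real U - \<i> * of_real \<phi>))) \<le> exp (- (z * cos \<theta>) * cosh U)"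
        by (intro onorm_le) (simp add: norm_mult, metis abs_ge_zero exp_le_cancel_iff mult.commute mult_left_mono neg_le_iff_le)
    qed auto
    then show ?thesis by simp
  qed
  have "((\<lambda>U. exp (- (z * cos \<theta>) * cosh U) * \<bar>\<theta>\<bar>) \<longlongrightarrow> 0) at_top"
  proof -
    have "filterlim (\<lambda>U. z * cos \<theta> * cosh U) at_top at_top"
      using z cos_pos by (intro filterlim_tendsto_pos_mult_at_top[OF tendsto_const _ cosh_real_at_top]) auto
    then have "((\<lambda>U. exp (- (z * cos \<theta> * cosh U))) \<longlongrightarrow> 0) at_top"
      by (intro filterlim_compose[OF exp_at_bot]) (simp add: filterlim_uminus_at_bot)
    then show ?thesis
      by (auto intro!: tendsto_mult_left_zero)
  qed
  then have edge_lim: "((\<lambda>U. H (of_real U - \<i> * of_real \<theta>) - H (of_real U)) \<longlongrightarrow> 0) at_top"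
    by (rule Lim_null_comparison[OF always_eventually, rotated]) (use right_edge in auto)
  have K0_lim: "((\<lambda>U. LINT u:{0..U}|lborel. exp (- z * cosh u)) \<longlongrightarrow> bessel_K0 z) at_top"
    unfolding bessel_K0_def
    by (intro tendsto_set_lebesgue_integral_at_top bessel_K0_set_integrable z) auto
  have "filterlim (\<lambda>U. \<beta> * sinh U) at_top at_top"
    using \<beta> by (intro filterlim_tendsto_pos_mult_at_top[OF tendsto_const _ sinh_real_at_top]) auto
  then have pw_lim: "((\<lambda>U. Re (LINT \<mu>:{0..\<beta> * sinh U}|lborel. plane_wave \<beta> x y \<mu>)) \<longlongrightarrow>
      Re (LINT \<mu>:{0..}|lborel. plane_wave \<beta> x y \<mu>)) at_top"
    by (intro tendsto_Re filterlim_compose[OF tendsto_set_lebesgue_integral_at_top]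
          set_integrable_plane_wave \<beta> x) auto
  \<comment> \<open>By \<open>left_edge\<close> this sum equals the truncated plane wave integral
    for \<open>U >= 0\<close>; uniqueness of limits then identifies the two full integrals.\<close>
  have "((\<lambda>U. (LINT u:{0..U}|lborel. exp (- z * cosh u)) + Re (H (of_real U - \<i> * of_real \<theta>) - H (of_real U)))
      \<longlongrightarrow> bessel_K0 z + Re 0) at_top"
    by (intro tendsto_add K0_lim tendsto_Re edge_lim)
  then have "((\<lambda>U. Re (LINT \<mu>:{0..\<beta> * sinh U}|lborel. plane_wave \<beta> x y \<mu>)) \<longlongrightarrow> bessel_K0 z + Re 0) at_top"
  proof (rule Lim_transform_eventually)
    show "\<forall>\<^sub>F U in at_top. (LINT u:{0..U}|lborel. exp (- z * cosh u)) + Re (H (of_real U - \<i> * of_real \<theta>) - H (of_real U))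
        = Re (LINT \<mu>:{0..\<beta> * sinh U}|lborel. plane_wave \<beta> x y \<mu>)"
      using eventually_ge_at_top[of 0]
    proof eventually_elim
      case (elim U)
      then show ?case
        unfolding int_K0[OF elim] int_pw[OF elim] using left_edge by simp
    qed
  qed
  from tendsto_unique[OF _ this pw_lim] show ?thesis
    by (simp add: z_def r_def)
qed

section \<open>Rows of images as geometric series\<close>

text \<open>Closed form of the sum over k >= 0 of the plane waves at (x + k d, y), divided by 2 pi:
  a half-infinite row of images whose nearest member sees the target at offset (x, y).\<close>

definition image_row_integrand :: "real \<Rightarrow> real \<Rightarrow> real \<Rightarrow> real \<Rightarrow> real \<Rightarrow> complex" where
  "image_row_integrand \<beta> d x y \<mu> = plane_wave \<beta> x y \<mu> / of_real (2 * pi * (1 - exp (- \<sigma> \<beta> \<mu> * d)))"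

lemma plane_wave_translate:
  "plane_wave \<beta> (x + a) y \<mu> = of_real (exp (- \<sigma> \<beta> \<mu> * a)) * plane_wave \<beta> x y \<mu>"
proof -
  have "- \<sigma> \<beta> \<mu> * (x + a) = - \<sigma> \<beta> \<mu> * a + - \<sigma> \<beta> \<mu> * x"
    by (simp add: algebra_simps)
  then show ?thesis
    by (simp only: plane_wave_def exp_add of_real_mult of_real_divide times_divide_eq_left times_divide_eq_right mult.assoc)
qed

text \<open>The ratio exp(-\<sigma> d) is at most exp(-\<beta> d) < 1 uniformly in \<mu>. Hence the
  L1 norms of the terms are dominated by a geometric series, which permits exchanging sum and
  integral and makes the limit integrable.\<close>

lemma
  fixes \<beta> d x y :: real
  assumes \<beta>: "\<beta> > 0" and d: "d > 0" and x: "x > 0"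
  shows image_row_integrable: "set_integrable lborel {0..} (image_row_integrand \<beta> d x y)" (is ?int)
    and image_row_sums: "(\<lambda>k. bessel_K0 (\<beta> * norm (x + real k * d, y)) / (2 * pi)) sums
      Re (LINT \<mu>:{0..}|lborel. image_row_integrand \<beta> d x y \<mu>)" (is ?sums)
proof -
  define f where "f k \<mu> = indicator {0..} \<mu> *\<^sub>R (plane_wave \<beta> (x + real k * d) y \<mu> / of_real (2 * pi))" for k \<mu>
  define q where "q \<mu> = exp (- \<sigma> \<beta> \<mu> * d)" for \<mu>
  have q: "0 \<le> q \<mu>" "q \<mu> < 1" "q \<mu> \<le> exp (- \<beta> * d)" for \<mu>
    using sigma_pos[OF \<beta>, of \<mu>] sigma_ge[OF \<beta>, of \<mu>] d by (auto simp: q_def)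
  have f_eq: "f k \<mu> = of_real (q \<mu>) ^ k * f 0 \<mu>" for k \<mu>
  proof -
    have "exp (- \<sigma> \<beta> \<mu> * (real k * d)) = q \<mu> ^ k"
      unfolding q_def exp_of_nat_mult[symmetric] by (simp add: mult_ac)
    then show ?thesis
      unfolding f_def plane_wave_translate by simp
  qed
  have int_f: "integrable lborel (f k)" for k
  proof -
    have "x + real k * d > 0" using x d by (intro add_pos_nonneg) auto
    from set_integrable_plane_wave[OF \<beta> this, of y] show ?thesis
      unfolding f_def set_integrable_def[symmetric] by (intro set_integrable_divide)
  qed
  have norm_f: "norm (f k \<mu>) \<le> exp (- \<beta> * d) ^ k * norm (f 0 \<mu>)" for k \<mu>
    using q[of \<mu>] by (subst f_eq) (auto simp: norm_mult norm_power intro!: mult_right_mono power_mono)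
  have sums_f: "(\<lambda>k. f k \<mu>) sums (indicator {0..} \<mu> *\<^sub>R image_row_integrand \<beta> d x y \<mu>)" for \<mu>
  proof -
    have "(\<lambda>k. of_real (q \<mu>) ^ k * f 0 \<mu>) sums (1 / (1 - of_real (q \<mu>)) * f 0 \<mu>)"
      using q[of \<mu>] by (intro sums_mult2 geometric_sums) auto
    also have "1 / (1 - of_real (q \<mu>)) * f 0 \<mu> = indicator {0..} \<mu> *\<^sub>R image_row_integrand \<beta> d x y \<mu>"
      by (simp add: f_def image_row_integrand_def q_def)
    also have "(\<lambda>k. of_real (q \<mu>) ^ k * f 0 \<mu>) = (\<lambda>k. f k \<mu>)"
      by (rule ext, rule f_eq[symmetric])
    finally show ?thesis .
  qed
  have summable_norm: "AE \<mu> in lborel. summable (\<lambda>k. norm (f k \<mu>))"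
  proof (intro AE_I2)
    fix \<mu>
    have "(\<lambda>k. norm (f k \<mu>)) = (\<lambda>k. q \<mu> ^ k * norm (f 0 \<mu>))"
    proof
      show "norm (f k \<mu>) = q \<mu> ^ k * norm (f 0 \<mu>)" for k
        using q[of \<mu>] by (subst f_eq) (simp add: norm_mult norm_power)
    qed
    moreover have "summable (\<lambda>k. q \<mu> ^ k * norm (f 0 \<mu>))"
      using q[of \<mu>] by (intro summable_mult2 summable_geometric) auto
    ultimately show "summable (\<lambda>k. norm (f k \<mu>))"
      by (simp only:)
  qed
  have summable_int: "summable (\<lambda>k. \<integral>\<mu>. norm (f k \<mu>) \<partial>lborel)"
  proof (rule summable_comparison_test')
    show "summable (\<lambda>k. exp (- \<beta> * d) ^ k * (\<integral>\<mu>. norm (f 0 \<mu>) \<partial>lborel))"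
      using \<beta> d by (intro summable_mult2 summable_geometric) auto
    fix k
    have "(\<integral>\<mu>. norm (f k \<mu>) \<partial>lborel) \<le> (\<integral>\<mu>. exp (- \<beta> * d) ^ k * norm (f 0 \<mu>) \<partial>lborel)"
      by (intro integral_mono int_f integrable_norm integrable_mult_right norm_f)
    then show "norm (\<integral>\<mu>. norm (f k \<mu>) \<partial>lborel) \<le> exp (- \<beta> * d) ^ k * (\<integral>\<mu>. norm (f 0 \<mu>) \<partial>lborel)"
      by simp
  qed
  have sum_f: "(\<lambda>\<mu>. \<Sum>k. f k \<mu>) = (\<lambda>\<mu>. indicator {0..} \<mu> *\<^sub>R image_row_integrand \<beta> d x y \<mu>)"
    using sums_f by (intro ext) (simp add: sums_iff)
  show ?int
    using integrable_suminf[OF int_f summable_norm summable_int]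
    unfolding sum_f set_integrable_def .
  have "(\<lambda>k. integral\<^sup>L lborel (f k)) sums (LINT \<mu>:{0..}|lborel. image_row_integrand \<beta> d x y \<mu>)"
    using sums_integral[OF int_f summable_norm summable_int]
    unfolding sum_f set_lebesgue_integral_def .
  moreover have "Re (integral\<^sup>L lborel (f k)) = bessel_K0 (\<beta> * norm (x + real k * d, y)) / (2 * pi)" for k
  proof -
    have "x + real k * d > 0" using x d by (intro add_pos_nonneg) auto
    moreover have "integral\<^sup>L lborel (f k) = (LINT \<mu>:{0..}|lborel. plane_wave \<beta> (x + real k * d) y \<mu>) / of_real (2 * pi)"
      unfolding f_def set_lebesgue_integral_def[symmetric] by (rule set_integral_divide_zero)
    ultimately show ?thesis
      using bessel_K0_eq_plane_wave_integral[OF \<beta>] by (simp only: Re_divide_of_real)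
  qed
  ultimately show ?sums
    using sums_Re[of "\<lambda>k. integral\<^sup>L lborel (f k)"] by simp
qed

text \<open>Reindexing m = -K - k makes \<open>K\<close> the number of periods to the nearest image;
  \<open>a\<close> is the offset of the row. Nonnegativity of the terms turns the ordered series
  into an unordered sum.\<close>

lemma image_row_infsum:
  fixes \<beta> d :: real and t s a :: point and K :: nat
  assumes "\<beta> > 0" "d > 0" "fst t - fst s - fst a + real K * d > 0"
  shows "(\<Sum>\<^sub>\<infinity>m\<in>{..- int K}. G \<beta> t (s + ((of_int m * d, 0) + a))) =
    Re (LINT \<mu>:{0..}|lborel. image_row_integrand \<beta> d (fst t - fst s - fst a + real K * d) (snd t - snd s - snd a) \<mu>)"
proof -
  have bij: "bij_betw (\<lambda>k. - int K - int k) UNIV {..- int K}"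
    by (rule bij_betwI[where g = "\<lambda>m. nat (- int K - m)"]) auto
  have G: "G \<beta> t (s + ((of_int (- int K - int k) * d, 0) + a)) =
    bessel_K0 (\<beta> * norm (fst t - fst s - fst a + real K * d + real k * d, snd t - snd s - snd a)) / (2 * pi)" for k
  proof -
    have eq: "t - (s + ((of_int (- int K - int k) * d, 0) + a)) =
      (fst t - fst s - fst a + real K * d + real k * d, snd t - snd s - snd a)"
      by (simp add: prod_eq_iff algebra_simps)
    show ?thesis unfolding G_def eq ..
  qed
  have "((\<lambda>k. bessel_K0 (\<beta> * norm (fst t - fst s - fst a + real K * d + real k * d, snd t - snd s - snd a)) / (2 * pi))
    has_sum Re (LINT \<mu>:{0..}|lborel. image_row_integrand \<beta> d (fst t - fst s - fst a + real K * d) (snd t - snd s - snd a) \<mu>)) UNIV"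
    by (rule sums_nonneg_imp_has_sum[OF image_row_sums[OF assms]]) (simp add: bessel_K0_nonneg)
  then show ?thesis
    unfolding infsum_reindex_bij_betw[OF bij, where f = "\<lambda>m. G \<beta> t (s + ((of_int m * d, 0) + a))", symmetric] G
    by (rule infsumI)
qed

section \<open>Integral representations of the west kernels\<close>

text \<open>The nearest west image is m = -2; moving it by \<open>2 * d\<close> produces the factor
  exp(-2 \<sigma> d).\<close>

lemma F1_eq_image_row_integrand:
  "F1 \<beta> d t s \<mu> = image_row_integrand \<beta> d (fst t - fst s + 2 * d) (snd t - snd s) \<mu>"
  unfolding image_row_integrand_def plane_wave_translate
  by (simp add: F1_def plane_wave_def field_simps)

text \<open>Displacing a row by n(\<xi>, \<eta>) multiplies its plane wave by exp(n \<sigma> \<xi> -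
  i n \<mu> \<eta>). The bracket in \<open>F2\<close> collects these factors for n = -1, 1,
  0.\<close>

lemma F2_eq_image_row_integrand:
  "F2 \<beta> d \<xi> \<eta> t s \<mu> = (\<Sum>n\<in>{-1..1}. image_row_integrand \<beta> d
     (fst t - fst s - of_int n * \<xi> + 4 * d) (snd t - snd s - of_int n * \<eta>) \<mu>)"
proof -
  have shift: "plane_wave \<beta> (x - c * \<xi> + 4 * d) (y - c * \<eta>) \<mu> =
      plane_wave \<beta> x y \<mu> * of_real (exp (- 4 * \<sigma> \<beta> \<mu> * d)) *
      exp (of_real (c * (\<sigma> \<beta> \<mu> * \<xi>)) - \<i> * of_real (c * (\<mu> * \<eta>)))" for x y c
  proof -
    have "- \<sigma> \<beta> \<mu> * (x - c * \<xi> + 4 * d) = - \<sigma> \<beta> \<mu> * x + c * (\<sigma> \<beta> \<mu> * \<xi>) + - 4 * \<sigma> \<beta> \<mu> * d"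
      "\<mu> * (y - c * \<eta>) = \<mu> * y - c * (\<mu> * \<eta>)"
      by (simp_all add: algebra_simps)
    then show ?thesis
      unfolding plane_wave_def
      by (simp only: exp_add of_real_mult of_real_divide of_real_diff right_diff_distrib exp_diff exp_of_real[symmetric]
          times_divide_eq_left times_divide_eq_right mult_ac)
  qed
  have set: "{-1..1::int} = {-1, 0, 1}" by auto
  have "(\<Sum>n\<in>{-1..1}. image_row_integrand \<beta> d
     (fst t - fst s - of_int n * \<xi> + 4 * d) (snd t - snd s - of_int n * \<eta>) \<mu>) =
     plane_wave \<beta> (fst t - fst s) (snd t - snd s) \<mu> * of_real (exp (- 4 * \<sigma> \<beta> \<mu> * d)) *
     (\<Sum>n\<in>{-1..1::int}. exp (of_real (of_int n * (\<sigma> \<beta> \<mu> * \<xi>)) - \<i> * of_real (of_int n * (\<mu> * \<eta>))))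
     / of_real (2 * pi * (1 - exp (- \<sigma> \<beta> \<mu> * d)))"
    unfolding image_row_integrand_def shift
    by (simp only: sum_divide_distrib[symmetric] sum_distrib_left[symmetric])
  also have "(\<Sum>n\<in>{-1..1::int}. exp (of_real (of_int n * (\<sigma> \<beta> \<mu> * \<xi>)) - \<i> * of_real (of_int n * (\<mu> * \<eta>)))) =
     exp (of_real (- \<sigma> \<beta> \<mu> * \<xi>) + \<i> * of_real (\<mu> * \<eta>))
        + exp (of_real (\<sigma> \<beta> \<mu> * \<xi>) - \<i> * of_real (\<mu> * \<eta>)) + 1"
    unfolding set by simp
  also have "plane_wave \<beta> (fst t - fst s) (snd t - snd s) \<mu> * of_real (exp (- 4 * \<sigma> \<beta> \<mu> * d)) *
     (exp (of_real (- \<sigma> \<beta> \<mu> * \<xi>) + \<i> * of_real (\<mu> * \<eta>))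
        + exp (of_real (\<sigma> \<beta> \<mu> * \<xi>) - \<i> * of_real (\<mu> * \<eta>)) + 1)
     / of_real (2 * pi * (1 - exp (- \<sigma> \<beta> \<mu> * d))) = F2 \<beta> d \<xi> \<eta> t s \<mu>"
    unfolding F2_def plane_wave_def
    by (simp only: of_real_mult of_real_divide times_divide_eq_left times_divide_eq_right divide_divide_eq_left mult_ac)
  finally show ?thesis ..
qed

lemma K1_west_eq_integral:
  assumes "\<beta> > 0" "d > 0" "t \<in> cell1 d \<eta>" "s \<in> cell1 d \<eta>"
  shows "K1_west \<beta> d t s = Re (LINT \<mu>:{0..}|lborel. F1 \<beta> d t s \<mu>)"
proof -
  \<comment> \<open>Abscissae in the cell differ by at most \<open>d\<close>, so the nearest image
    lies at least \<open>d\<close> west of the target.\<close>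
  have "fst t - fst s + real 2 * d > 0"
    using assms by (auto simp: cell1_def)
  then show ?thesis
    using image_row_infsum[of \<beta> d t s 0 2] assms(1,2)
    unfolding K1_west_def F1_eq_image_row_integrand by (simp add: period_def)
qed

text \<open>Since \<open>\<eta> > 0\<close>, the length condition forces |\<xi>| < d. Abscissae
  differ by at most d + |\<xi>| and the row offset adds at most |\<xi>|, so the total stays below
  3d.\<close>

lemma cell2_image_to_the_west:
  assumes "d > 0" "\<eta> > 0" "d \<ge> sqrt (\<xi>\<^sup>2 + \<eta>\<^sup>2)" "t \<in> cell2 d \<xi> \<eta>" "s \<in> cell2 d \<xi> \<eta>" "\<bar>c\<bar> \<le> 1"
  shows "fst t - fst s - c * \<xi> + 4 * d > 0"
proof -
  have \<xi>: "\<bar>\<xi>\<bar> < d"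
    using assms(2,3) real_sqrt_less_mono[of "\<xi>\<^sup>2" "\<xi>\<^sup>2 + \<eta>\<^sup>2"] by simp
  have fst_le: "\<bar>fst p\<bar> \<le> d / 2 + \<bar>\<xi>\<bar> / 2" if "p \<in> cell2 d \<xi> \<eta>" for p
  proof -
    from that obtain x1 x2 where p: "fst p = x1 * d + x2 * \<xi>" "\<bar>x1\<bar> \<le> 1 / 2" "\<bar>x2\<bar> \<le> 1 / 2"
      by (auto simp: cell2_def abs_le_iff)
    have "\<bar>x1 * d\<bar> \<le> 1 / 2 * \<bar>d\<bar>"
      unfolding abs_mult by (rule mult_right_mono[OF p(2) abs_ge_zero])
    moreover have "\<bar>x2 * \<xi>\<bar> \<le> 1 / 2 * \<bar>\<xi>\<bar>"
      unfolding abs_mult by (rule mult_right_mono[OF p(3) abs_ge_zero])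
    ultimately show ?thesis unfolding p(1) using assms(1) by linarith
  qed
  have "\<bar>c * \<xi>\<bar> \<le> 1 * \<bar>\<xi>\<bar>"
    unfolding abs_mult using assms(6) by (intro mult_right_mono) auto
  with \<xi> fst_le[OF assms(4)] fst_le[OF assms(5)] show ?thesis by linarith
qed

lemma K2_west_eq_integral:
  assumes "\<beta> > 0" "d > 0" "\<eta> > 0" "d \<ge> sqrt (\<xi>\<^sup>2 + \<eta>\<^sup>2)" "t \<in> cell2 d \<xi> \<eta>" "s \<in> cell2 d \<xi> \<eta>"
  shows "K2_west \<beta> d \<xi> \<eta> t s = Re (LINT \<mu>:{0..}|lborel. F2 \<beta> d \<xi> \<eta> t s \<mu>)"
proof -
  define f where "f n \<mu> = image_row_integrand \<beta> d
     (fst t - fst s - of_int n * \<xi> + 4 * d) (snd t - snd s - of_int n * \<eta>) \<mu>" for n :: int and \<mu>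
  have pos: "fst t - fst s - of_int n * \<xi> + 4 * d > 0" if "n \<in> {-1..1}" for n
    using that assms by (intro cell2_image_to_the_west) auto
  have "(\<Sum>\<^sub>\<infinity>m\<in>{..-4}. G \<beta> t (s + lattice d \<xi> \<eta> m n)) = Re (LINT \<mu>:{0..}|lborel. f n \<mu>)"
    if "n \<in> {-1..1}" for n
    using image_row_infsum[of \<beta> d t s "(of_int n * \<xi>, of_int n * \<eta>)" 4] pos[OF that] assms
    by (simp add: lattice_def f_def)
  then have "K2_west \<beta> d \<xi> \<eta> t s = (\<Sum>n\<in>{-1..1}. Re (LINT \<mu>:{0..}|lborel. f n \<mu>))"
    unfolding K2_west_def by (intro sum.cong refl)
  \<comment> \<open>Additivity of the integral needs every row to be integrable separately, which
    holds because each row lies strictly west of the target.\<close>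
  also have "\<dots> = Re (LINT \<mu>:{0..}|lborel. \<Sum>n\<in>{-1..1}. f n \<mu>)"
    unfolding set_lebesgue_integral_def scaleR_sum_right Re_sum[symmetric]
  proof (subst Bochner_Integration.integral_sum)
    fix n :: int assume "n \<in> {-1..1}"
    from image_row_integrable[OF assms(1,2) pos[OF this]]
    show "integrable lborel (\<lambda>\<mu>. indicator {0..} \<mu> *\<^sub>R f n \<mu>)"
      unfolding set_integrable_def f_def .
  qed simp
  also have "(\<lambda>\<mu>. \<Sum>n\<in>{-1..1}. f n \<mu>) = F2 \<beta> d \<xi> \<eta> t s"
    by (simp add: fun_eq_iff F2_eq_image_row_integrand f_def)
  finally show ?thesis .
qed

section \<open>Convergence of the lattice sums and splitting of the far kernels\<close>

lemma summable_on_exp_minus_abs_int: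
  fixes b :: real
  assumes "b > 0"
  shows "(\<lambda>m::int. exp (- b * \<bar>of_int m\<bar>)) summable_on UNIV"
proof -
  have "summable (\<lambda>k. exp (- b * real k))"
    using assms summable_geometric[of "exp (- b)"] unfolding exp_of_nat_mult[symmetric] by (simp add: mult.commute)
  then have nat: "(\<lambda>k. exp (- b * real k)) summable_on UNIV"
    by (rule summable_nonneg_imp_summable_on) auto
  have "(\<lambda>m::int. exp (- b * \<bar>of_int m\<bar>)) summable_on (range int)"
    unfolding summable_on_reindex[OF inj_on_of_nat] using nat by (simp add: o_def)
  \<comment> \<open>The negative half starts at 1, so that 0 is counted once.\<close>
  moreover have "(\<lambda>m::int. exp (- b * \<bar>of_int m\<bar>)) summable_on ((\<lambda>k. - int k) ` {1..})"
    by (subst summable_on_reindex)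
      (use summable_on_subset_banach[OF nat, of "{1..}"] in \<open>auto simp: o_def inj_on_def\<close>)
  moreover have "range int \<inter> (\<lambda>k. - int k) ` {1..} = {}" by auto
  moreover have "range int \<union> (\<lambda>k. - int k) ` {1..} = UNIV"
  proof -
    have "m \<in> range int \<union> (\<lambda>k. - int k) ` {1..}" for m
      by (cases m) (auto intro!: image_eqI[where x = "Suc _"])
    then show ?thesis by auto
  qed
  ultimately show ?thesis
    using summable_on_Un_disjoint by metis
qed

text \<open>The exponential factors, so the double sum is a product of two single sums.\<close>

lemma summable_on_exp_minus_abs_int_pair:
  fixes b :: real
  assumes "b > 0"
  shows "(\<lambda>(m::int, n::int). exp (- b * (\<bar>of_int m\<bar> + \<bar>of_int n\<bar>))) summable_on UNIV"
proof -
  let ?g = "\<lambda>m::int. exp (- b * \<bar>of_int m\<bar>)"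
  have "(\<lambda>(m, n). exp (- b * (\<bar>of_int m\<bar> + \<bar>of_int n\<bar>))) summable_on Sigma UNIV (\<lambda>_. UNIV)"
  proof (rule summable_on_SigmaI)
    fix m :: int
    show "((\<lambda>n. case (m, n) of (m, n) \<Rightarrow> exp (- b * (\<bar>of_int m\<bar> + \<bar>of_int n\<bar>))) has_sum ?g m * infsum ?g UNIV) UNIV"
      using has_sum_cmult_right[OF has_sum_infsum[OF summable_on_exp_minus_abs_int[OF assms]], of "?g m"]
      by (simp add: distrib_left exp_add[symmetric])
    show "(\<lambda>m. ?g m * infsum ?g UNIV) summable_on UNIV"
      by (intro summable_on_cmult_left summable_on_exp_minus_abs_int assms)
  qed simp
  then show ?thesis by simp
qed

text \<open>Quantitative independence of the period vectors: the second coordinate controls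
  \<open>n\<close>, and after removing n\<xi> the first coordinate controls \<open>m\<close>. The
  constant adds the two bounds.\<close>

lemma norm_lattice_ge:
  assumes "d > 0" "\<eta> > 0"
  shows "\<bar>of_int m\<bar> + \<bar>of_int n\<bar> \<le> norm (lattice d \<xi> \<eta> m n) * (1 / \<eta> + (1 + \<bar>\<xi>\<bar> / \<eta>) / d)"
proof -
  define N where "N = norm (lattice d \<xi> \<eta> m n)"
  have "\<bar>of_int n\<bar> * \<eta> \<le> N"
    using norm_snd_le[where y = "of_int n * \<eta>" and x = "of_int m * d + of_int n * \<xi>"] assms by (simp add: N_def lattice_def abs_mult)
  then have n: "\<bar>of_int n\<bar> \<le> N / \<eta>"
    using assms by (simp add: field_simps)
  have "\<bar>of_int m * d + of_int n * \<xi>\<bar> \<le> N"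
    using norm_fst_le[where y = "of_int n * \<eta>" and x = "of_int m * d + of_int n * \<xi>"] by (simp add: N_def lattice_def)
  moreover have "\<bar>of_int n * \<xi>\<bar> \<le> N / \<eta> * \<bar>\<xi>\<bar>"
    unfolding abs_mult using n by (rule mult_right_mono) simp
  ultimately have "\<bar>of_int m * d\<bar> \<le> N + N / \<eta> * \<bar>\<xi>\<bar>" by linarith
  then have "\<bar>of_int m\<bar> \<le> (N + N / \<eta> * \<bar>\<xi>\<bar>) / d"
    using assms by (simp add: abs_mult pos_le_divide_eq)
  with n have "\<bar>of_int m\<bar> + \<bar>of_int n\<bar> \<le> N / \<eta> + (N + N / \<eta> * \<bar>\<xi>\<bar>) / d" by linarith
  also have "\<dots> = N * (1 / \<eta> + (1 + \<bar>\<xi>\<bar> / \<eta>) / d)"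
    using assms by (simp add: field_simps)
  finally show ?thesis unfolding N_def .
qed

text \<open>By the triangle inequality the Bessel argument \<open>z m n\<close> grows at least
  linearly in |m| + |n|. Where it is at least 1, \<open>bessel_K0_le\<close> gives an exponential
  majorant; the remaining images are finitely many.\<close>

lemma G_lattice_summable:
  assumes "\<beta> > 0" "d > 0" "\<eta> > 0"
  shows "(\<lambda>(m, n). G \<beta> t (s + lattice d \<xi> \<eta> m n)) summable_on I"
proof -
  define B where "B = 1 / \<eta> + (1 + \<bar>\<xi>\<bar> / \<eta>) / d"
  have B: "B > 0" unfolding B_def using assms by (intro add_pos_pos divide_pos_pos add_pos_nonneg) auto
  define a A where "a = \<beta> / B" and "A = \<beta> * norm (t - s)"
  have a: "a > 0" using assms B by (simp add: a_def)
  define z where "z m n = \<beta> * norm (t - (s + lattice d \<xi> \<eta> m n))" for m n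
  have z_ge: "a * (\<bar>of_int m\<bar> + \<bar>of_int n\<bar>) - A \<le> z m n" for m n
  proof -
    have "(\<bar>of_int m\<bar> + \<bar>of_int n\<bar>) / B \<le> norm (lattice d \<xi> \<eta> m n)"
      using norm_lattice_ge[OF assms(2,3), of m n \<xi>] B by (simp add: B_def[symmetric] field_simps)
    also have "\<dots> \<le> norm (t - (s + lattice d \<xi> \<eta> m n)) + norm (t - s)"
      using norm_triangle_sub[of "lattice d \<xi> \<eta> m n" "t - s"]
      by (simp add: norm_minus_commute algebra_simps)
    finally have "\<beta> * ((\<bar>of_int m\<bar> + \<bar>of_int n\<bar>) / B) \<le> \<beta> * (norm (t - (s + lattice d \<xi> \<eta> m n)) + norm (t - s))"
      using assms by (intro mult_left_mono) auto
    then show ?thesis by (simp add: a_def A_def z_def distrib_left add_divide_distrib)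
  qed
  define S where "S = {(m, n). z m n \<ge> 1}"
  define M where "M = \<lceil>(1 + A) / a\<rceil>"
  have near: "- S \<subseteq> {-M..M} \<times> {-M..M}"
  proof clarify
    fix m n :: int assume "(m, n) \<notin> S"
    then have "a * (\<bar>of_int m\<bar> + \<bar>of_int n\<bar>) \<le> 1 + A"
      using z_ge[of m n] by (simp add: S_def)
    then have "\<bar>of_int m\<bar> + \<bar>of_int n\<bar> \<le> (1 + A) / a"
      using a by (simp add: field_simps)
    also have "\<dots> \<le> of_int M" unfolding M_def by (rule le_of_int_ceiling)
    finally have "\<bar>m\<bar> + \<bar>n\<bar> \<le> M"
      by (simp only: of_int_abs[symmetric] of_int_add[symmetric] of_int_le_iff)
    then show "m \<in> {-M..M} \<and> n \<in> {-M..M}" by auto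
  qed
  have "(\<lambda>(m, n). G \<beta> t (s + lattice d \<xi> \<eta> m n)) summable_on S"
  proof (rule summable_on_comparison_test)
    have "(\<lambda>(m, n). exp (- (a / 2) * (\<bar>of_int m\<bar> + \<bar>of_int n\<bar>))) summable_on S"
      using a by (intro summable_on_subset_banach[OF summable_on_exp_minus_abs_int_pair]) auto
    \<comment> \<open>The rate \<open>a / 2\<close> and the factor \<open>exp (A / 2)\<close> come
      from the halved exponent in \<open>bessel_K0_le\<close>; its 2 cancels against
      \<open>2 * pi\<close>.\<close>
    then show "(\<lambda>p. exp (A / 2) / pi * (case p of (m, n) \<Rightarrow> exp (- (a / 2) * (\<bar>of_int m\<bar> + \<bar>of_int n\<bar>)))) summable_on S"
      by (rule summable_on_cmult_right)
    fix p assume "p \<in> S"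
    then obtain m n where p: "p = (m, n)" "z m n \<ge> 1" by (auto simp: S_def)
    have "bessel_K0 (z m n) \<le> 2 * exp (- z m n / 2)"
      by (rule bessel_K0_le[OF p(2)])
    also have "exp (- z m n / 2) \<le> exp (A / 2 + - (a / 2) * (\<bar>of_int m\<bar> + \<bar>of_int n\<bar>))"
      using z_ge[of m n] by (simp add: field_simps)
    finally have "bessel_K0 (z m n) \<le> 2 * (exp (A / 2) * exp (- (a / 2) * (\<bar>of_int m\<bar> + \<bar>of_int n\<bar>)))"
      unfolding exp_add by simp
    then have "bessel_K0 (z m n) / (2 * pi) \<le> 2 * (exp (A / 2) * exp (- (a / 2) * (\<bar>of_int m\<bar> + \<bar>of_int n\<bar>))) / (2 * pi)"
      by (intro divide_right_mono) auto
    then show "(case p of (m, n) \<Rightarrow> G \<beta> t (s + lattice d \<xi> \<eta> m n)) \<le>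
        exp (A / 2) / pi * (case p of (m, n) \<Rightarrow> exp (- (a / 2) * (\<bar>of_int m\<bar> + \<bar>of_int n\<bar>)))"
      by (simp add: p G_def z_def)
  qed (auto simp: G_def bessel_K0_nonneg)
  moreover have "(\<lambda>(m, n). G \<beta> t (s + lattice d \<xi> \<eta> m n)) summable_on - S"
    by (intro summable_on_finite finite_subset[OF near]) auto
  ultimately have "(\<lambda>(m, n). G \<beta> t (s + lattice d \<xi> \<eta> m n)) summable_on (S \<union> - S)"
    by (intro summable_on_Un_disjoint) auto
  then show ?thesis
    by (rule summable_on_subset_banach) auto
qed

text \<open>The singly periodic images form the row n = 0 of an auxiliary rectangular lattice with
  second period (0, 1).\<close>

lemma G_period_summable:
  assumes "\<beta> > 0" "d > 0"
  shows "(\<lambda>m. G \<beta> t (s + period d m)) summable_on I"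
proof -
  have "(\<lambda>(m, n). G \<beta> t (s + lattice d 0 1 m n)) summable_on ((\<lambda>m. (m, 0)) ` I)"
    using assms by (intro G_lattice_summable) auto
  then show ?thesis
    by (subst (asm) summable_on_reindex) (auto simp: inj_on_def o_def lattice_def period_def)
qed

text \<open>Since \<open>infsum\<close> defaults to 0 on non-summable families, the splitting rests
  on summability over both pieces.\<close>

lemma K1_images_far_split:
  assumes "\<beta> > 0" "d > 0"
  shows "K1_images far1 \<beta> d t s = K1_west \<beta> d t s + K1_images (far1 - west1) \<beta> d t s"
proof -
  have "far1 = west1 \<union> (far1 - west1)" by (auto simp: west1_def far1_def)
  then have "K1_images far1 \<beta> d t s = K1_images (west1 \<union> (far1 - west1)) \<beta> d t s" by simp
  also have "\<dots> = K1_west \<beta> d t s + K1_images (far1 - west1) \<beta> d t s"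
    unfolding K1_images_def K1_west_def west1_def[symmetric]
    by (intro infsum_Un_disjoint G_period_summable assms) auto
  finally show ?thesis .
qed

lemma K2_images_far_split:
  assumes "\<beta> > 0" "d > 0" "\<eta> > 0"
  shows "K2_images far2 \<beta> d \<xi> \<eta> t s = K2_west \<beta> d \<xi> \<eta> t s + K2_images (far2 - west2) \<beta> d \<xi> \<eta> t s"
proof -
  have "far2 = west2 \<union> (far2 - west2)" by (auto simp: west2_def far2_def)
  then have "K2_images far2 \<beta> d \<xi> \<eta> t s = K2_images (west2 \<union> (far2 - west2)) \<beta> d \<xi> \<eta> t s" by simp
  also have "\<dots> = K2_images west2 \<beta> d \<xi> \<eta> t s + K2_images (far2 - west2) \<beta> d \<xi> \<eta> t s"
    unfolding K2_images_def by (intro infsum_Un_disjoint G_lattice_summable assms) auto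
  also have "K2_images west2 \<beta> d \<xi> \<eta> t s = K2_west \<beta> d \<xi> \<eta> t s"
  proof -
    \<comment> \<open>\<open>K2_west\<close> is an iterated sum with \<open>n\<close> outside,
      whereas \<open>K2_images\<close> runs over pairs; summability over the product justifies
      Fubini and the swap.\<close>
    have summable: "(\<lambda>(m, n). G \<beta> t (s + lattice d \<xi> \<eta> m n)) summable_on {..-4} \<times> {-1..1}"
      by (rule G_lattice_summable[OF assms])
    show ?thesis
      using infsum_swap_banach[OF summable] infsum_Sigma_banach[OF summable]
      by (simp add: K2_images_def K2_west_def west2_def)
  qed
  finally show ?thesis .
qed

section \<open>Matrix factorization and propagation of the quadrature error\<close>

lemma kernel_matrix_mult_index:
  assumes "q \<in> carrier_vec NS" "l < NT"
  shows "vec_index (kernel_matrix K NT NS t s *\<^sub>v q) l = (\<Sum>j<NS. K (t l) (s j) * vec_index q j)"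
  using assms by (auto simp: kernel_matrix_def scalar_prod_def lessThan_atLeast0 intro!: sum.cong)

lemma kernel_matrix_mult_add:
  assumes "q \<in> carrier_vec NS" and "\<And>x y. K x y = K' x y + K'' x y"
  shows "kernel_matrix K NT NS t s *\<^sub>v q = kernel_matrix K' NT NS t s *\<^sub>v q + kernel_matrix K'' NT NS t s *\<^sub>v q"
proof (rule eq_vecI)
  fix l assume "l < dim_vec (kernel_matrix K' NT NS t s *\<^sub>v q + kernel_matrix K'' NT NS t s *\<^sub>v q)"
  then have l: "l < NT" by (simp add: kernel_matrix_def)
  then have "vec_index (kernel_matrix K' NT NS t s *\<^sub>v q + kernel_matrix K'' NT NS t s *\<^sub>v q) l =
      vec_index (kernel_matrix K' NT NS t s *\<^sub>v q) l + vec_index (kernel_matrix K'' NT NS t s *\<^sub>v q) l"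
    by (intro index_add_vec) (simp add: kernel_matrix_def)
  then show "vec_index (kernel_matrix K NT NS t s *\<^sub>v q) l =
      vec_index (kernel_matrix K' NT NS t s *\<^sub>v q + kernel_matrix K'' NT NS t s *\<^sub>v q) l"
    by (simp only: kernel_matrix_mult_index[OF assms(1) l] assms(2) ring_distribs sum.distrib)
qed (simp add: kernel_matrix_def)

lemma mat_diag_sandwich_index:
  fixes L R :: "'a :: comm_semiring_1 mat"
  assumes "L \<in> carrier_mat NT N" "R \<in> carrier_mat N NS" "l < NT" "j < NS"
  shows "(L * mat_diag N D * R) $$ (l, j) = (\<Sum>n<N. L $$ (l, n) * D n * R $$ (n, j))"
  using assms unfolding mat_diag_mult_right[OF assms(1)]
  by (auto simp: scalar_prod_def lessThan_atLeast0 intro!: sum.cong)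

lemma re_apply_index:
  assumes "P \<in> carrier_mat NT NS" "q \<in> carrier_vec NS" "l < NT"
  shows "vec_index (re_apply P q) l = (\<Sum>j<NS. Re (P $$ (l, j)) * vec_index q j)"
  using assms by (auto simp: re_apply_def scalar_prod_def lessThan_atLeast0 intro!: sum.cong)

lemma P1_west_carrier: "P1_west \<beta> d NT NS N w lam t s \<in> carrier_mat NT NS"
  unfolding P1_west_def L_west_def R_west_def D1_ew_def
  by (intro mult_carrier_mat[of _ _ N] mat_diag_dim) auto

lemma P2_west_carrier: "P2_west \<beta> d \<xi> \<eta> NT NS N w lam t s \<in> carrier_mat NT NS"
  unfolding P2_west_def L_west_def R_west_def D2_west_def
  by (intro mult_carrier_mat[of _ _ N] mat_diag_dim) auto

text \<open>Separation of variables: the exponents are linear in target minus source, so they split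
  into a target factor and a source factor. The slot \<open>c\<close> takes the diagonal entry of
  either problem.\<close>

lemma L_west_R_west_product:
  assumes "l < NT" "j < NS" "n < N"
  shows "L_west \<beta> NT N lam t $$ (l, n) * c * R_west \<beta> N NS lam s $$ (n, j) =
    of_real (exp (- \<sigma> \<beta> (lam n) * (fst (t l) - fst (s j)))) * exp (\<i> * of_real (lam n * (snd (t l) - snd (s j)))) * c"
  using assms
  by (simp add: L_west_def R_west_def \<sigma>_def exp_of_real[symmetric] right_diff_distrib exp_diff exp_minus divide_inverse)

text \<open>The diagonal factor holds the weight and all of \<open>F1\<close> that depends on the
  node alone. The identity is exact, so the error of the factorization is precisely that of the
  quadrature.\<close>

lemma P1_west_index:
  assumes "l < NT" "j < NS"
  shows "P1_west \<beta> d NT NS N w lam t s $$ (l, j) = (\<Sum>n<N. of_real (w n) * F1 \<beta> d (t l) (s j) (lam n))"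
proof -
  have "P1_west \<beta> d NT NS N w lam t s $$ (l, j) =
    (\<Sum>n<N. L_west \<beta> NT N lam t $$ (l, n) * of_real (
     1 / (2 * pi) * (w n / sqrt ((lam n)\<^sup>2 + \<beta>\<^sup>2))
     * (exp (- 2 * sqrt ((lam n)\<^sup>2 + \<beta>\<^sup>2) * d) / (1 - exp (- sqrt ((lam n)\<^sup>2 + \<beta>\<^sup>2) * d)))) *
     R_west \<beta> N NS lam s $$ (n, j))"
    unfolding P1_west_def D1_ew_def
    by (intro mat_diag_sandwich_index[OF _ _ assms]) (simp_all add: L_west_def R_west_def)
  also have "\<dots> = (\<Sum>n<N. of_real (w n) * F1 \<beta> d (t l) (s j) (lam n))"
  proof (intro sum.cong refl)
    fix n assume "n \<in> {..<N}"
    then show "L_west \<beta> NT N lam t $$ (l, n) * of_real (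
     1 / (2 * pi) * (w n / sqrt ((lam n)\<^sup>2 + \<beta>\<^sup>2))
     * (exp (- 2 * sqrt ((lam n)\<^sup>2 + \<beta>\<^sup>2) * d) / (1 - exp (- sqrt ((lam n)\<^sup>2 + \<beta>\<^sup>2) * d)))) *
     R_west \<beta> N NS lam s $$ (n, j) = of_real (w n) * F1 \<beta> d (t l) (s j) (lam n)"
      by (simp add: L_west_R_west_product assms F1_def \<sigma>_def)
  qed
  finally show ?thesis .
qed

lemma P2_west_index:
  assumes "l < NT" "j < NS"
  shows "P2_west \<beta> d \<xi> \<eta> NT NS N w lam t s $$ (l, j) = (\<Sum>n<N. of_real (w n) * F2 \<beta> d \<xi> \<eta> (t l) (s j) (lam n))"
proof -
  \<comment> \<open>Naming the diagonal keeps it opaque until \<open>L_west_R_west_product\<close>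
    has been applied with \<open>D n\<close> as its \<open>c\<close>.\<close>
  define D where "D n = of_real (w n / sqrt ((lam n)\<^sup>2 + \<beta>\<^sup>2)
       * (exp (- 4 * sqrt ((lam n)\<^sup>2 + \<beta>\<^sup>2) * d) / (1 - exp (- sqrt ((lam n)\<^sup>2 + \<beta>\<^sup>2) * d))))
     * ((exp (of_real (- sqrt ((lam n)\<^sup>2 + \<beta>\<^sup>2) * \<xi>) + \<i> * of_real (lam n * \<eta>))
         + exp (of_real (sqrt ((lam n)\<^sup>2 + \<beta>\<^sup>2) * \<xi>) - \<i> * of_real (lam n * \<eta>)) + 1)
        / of_real (2 * pi))" for n
  have "P2_west \<beta> d \<xi> \<eta> NT NS N w lam t s $$ (l, j) =
    (\<Sum>n<N. L_west \<beta> NT N lam t $$ (l, n) * D n * R_west \<beta> N NS lam s $$ (n, j))"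
    unfolding P2_west_def D2_west_def D_def[symmetric]
    by (intro mat_diag_sandwich_index[OF _ _ assms]) (simp_all add: L_west_def R_west_def)
  also have "\<dots> = (\<Sum>n<N. of_real (w n) * F2 \<beta> d \<xi> \<eta> (t l) (s j) (lam n))"
  proof (intro sum.cong refl)
    fix n assume "n \<in> {..<N}"
    then show "L_west \<beta> NT N lam t $$ (l, n) * D n * R_west \<beta> N NS lam s $$ (n, j) =
        of_real (w n) * F2 \<beta> d \<xi> \<eta> (t l) (s j) (lam n)"
      by (simp only: L_west_R_west_product assms lessThan_iff) (simp add: D_def F2_def \<sigma>_def mult_ac)
  qed
  finally show ?thesis .
qed

text \<open>The bound \<epsilon> is uniform over pairs of points in \<open>C\<close>, so each charge
  contributes at most \<epsilon> times its modulus and the l1 norm of the charges appears.\<close>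

lemma quadrature_error:
  assumes quad: "quadrature \<epsilon> C F N w lam"
    and K: "\<And>x y. x \<in> C \<Longrightarrow> y \<in> C \<Longrightarrow> K x y = Re (LINT \<mu>:{0..}|lborel. F x y \<mu>)"
    and q: "q \<in> carrier_vec NS" and l: "l < NT"
    and s: "s ` {..<NS} \<subseteq> C" and t: "t ` {..<NT} \<subseteq> C"
  shows "\<bar>(\<Sum>j<NS. Re (\<Sum>n<N. of_real (w n) * F (t l) (s j) (lam n)) * vec_index q j)
      - vec_index (kernel_matrix K NT NS t s *\<^sub>v q) l\<bar> \<le> \<epsilon> * (\<Sum>j<NS. \<bar>vec_index q j\<bar>)"
proof -
  have "\<bar>\<Sum>j<NS. (Re (\<Sum>n<N. of_real (w n) * F (t l) (s j) (lam n)) - K (t l) (s j)) * vec_index q j\<bar>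
      \<le> (\<Sum>j<NS. \<epsilon> * \<bar>vec_index q j\<bar>)"
  proof (rule order_trans[OF sum_abs sum_mono])
    fix j assume "j \<in> {..<NS}"
    then have "t l \<in> C" "s j \<in> C" using s t l by auto
    then have "\<bar>Re (\<Sum>n<N. of_real (w n) * F (t l) (s j) (lam n)) - K (t l) (s j)\<bar> \<le> \<epsilon>"
      using quad K unfolding quadrature_def by (simp add: abs_minus_commute)
    then show "\<bar>(Re (\<Sum>n<N. of_real (w n) * F (t l) (s j) (lam n)) - K (t l) (s j)) * vec_index q j\<bar>
        \<le> \<epsilon> * \<bar>vec_index q j\<bar>"
      unfolding abs_mult by (rule mult_right_mono) simp
  qed
  then show ?thesis
    unfolding kernel_matrix_mult_index[OF q l]
    by (simp only: left_diff_distrib sum_subtractf sum_distrib_left)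
qed

text \<open>"Contribution of the west sources" is made precise in two stages: the far potential
  splits exactly into the west part and the rest, and the real part of the factorized product is the
  quadrature of the west part, with error controlled by \<epsilon> and the charges. Summability
  ensures that the far sums are genuine rather than default values.\<close>

theorem theorem3:
  fixes \<beta> d \<xi> \<eta> \<epsilon> :: real
    and NS NT Nq1 Nq2 :: nat
    and s t :: "nat \<Rightarrow> point"
    and q :: "real Matrix.vec"
    and w1 lam1 w2 lam2 :: "nat \<Rightarrow> real"
  assumes "\<beta> > 0" and "d > 0" and "\<eta> > 0" and "\<epsilon> > 0"
    and "q \<in> carrier_vec NS"
  shows
    "(s ` {..<NS} \<subseteq> cell1 d \<eta> \<longrightarrow> t ` {..<NT} \<subseteq> cell1 d \<eta> \<longrightarrow>
      quadrature \<epsilon> (cell1 d \<eta>) (F1 \<beta> d) Nq1 w1 lam1 \<longrightarrow>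
        west1 \<subseteq> far1 \<and>
        (\<forall>l<NT. \<forall>j<NS. (\<lambda>m. G \<beta> (t l) (s j + period d m)) summable_on far1) \<and>
        kernel_matrix (K1_images far1 \<beta> d) NT NS t s *\<^sub>v q =
          kernel_matrix (K1_west \<beta> d) NT NS t s *\<^sub>v q + kernel_matrix (K1_images (far1 - west1) \<beta> d) NT NS t s *\<^sub>v q \<and>
        (\<forall>l<NT.
          vec_index (re_apply (P1_west \<beta> d NT NS Nq1 w1 lam1 t s) q) l =
            (\<Sum>j<NS. Re (\<Sum>n<Nq1. of_real (w1 n) * F1 \<beta> d (t l) (s j) (lam1 n)) * vec_index q j) \<and>
          \<bar>vec_index (re_apply (P1_west \<beta> d NT NS Nq1 w1 lam1 t s) q) l
              - vec_index (kernel_matrix (K1_west \<beta> d) NT NS t s *\<^sub>v q) l\<bar>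
            \<le> \<epsilon> * (\<Sum>j<NS. \<bar>vec_index q j\<bar>)))
     \<and>
     (d \<ge> sqrt (\<xi>\<^sup>2 + \<eta>\<^sup>2) \<longrightarrow>
      s ` {..<NS} \<subseteq> cell2 d \<xi> \<eta> \<longrightarrow> t ` {..<NT} \<subseteq> cell2 d \<xi> \<eta> \<longrightarrow>
      quadrature \<epsilon> (cell2 d \<xi> \<eta>) (F2 \<beta> d \<xi> \<eta>) Nq2 w2 lam2 \<longrightarrow>
        west2 \<subseteq> far2 \<and>
        (\<forall>l<NT. \<forall>j<NS. (\<lambda>(m, n). G \<beta> (t l) (s j + lattice d \<xi> \<eta> m n)) summable_on far2) \<and>
        kernel_matrix (K2_images far2 \<beta> d \<xi> \<eta>) NT NS t s *\<^sub>v q =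
          kernel_matrix (K2_west \<beta> d \<xi> \<eta>) NT NS t s *\<^sub>v q + kernel_matrix (K2_images (far2 - west2) \<beta> d \<xi> \<eta>) NT NS t s *\<^sub>v q \<and>
        (\<forall>l<NT.
          vec_index (re_apply (P2_west \<beta> d \<xi> \<eta> NT NS Nq2 w2 lam2 t s) q) l =
            (\<Sum>j<NS. Re (\<Sum>n<Nq2. of_real (w2 n) * F2 \<beta> d \<xi> \<eta> (t l) (s j) (lam2 n)) * vec_index q j) \<and>
          \<bar>vec_index (re_apply (P2_west \<beta> d \<xi> \<eta> NT NS Nq2 w2 lam2 t s) q) l
              - vec_index (kernel_matrix (K2_west \<beta> d \<xi> \<eta>) NT NS t s *\<^sub>v q) l\<bar>
            \<le> \<epsilon> * (\<Sum>j<NS. \<bar>vec_index q j\<bar>)))"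
proof (intro conjI impI)
  assume s: "s ` {..<NS} \<subseteq> cell1 d \<eta>" and t: "t ` {..<NT} \<subseteq> cell1 d \<eta>"
    and quad: "quadrature \<epsilon> (cell1 d \<eta>) (F1 \<beta> d) Nq1 w1 lam1"
  show "west1 \<subseteq> far1" by (auto simp: west1_def far1_def)
  show "\<forall>l<NT. \<forall>j<NS. (\<lambda>m. G \<beta> (t l) (s j + period d m)) summable_on far1"
    using G_period_summable assms by blast
  show "kernel_matrix (K1_images far1 \<beta> d) NT NS t s *\<^sub>v q =
      kernel_matrix (K1_west \<beta> d) NT NS t s *\<^sub>v q + kernel_matrix (K1_images (far1 - west1) \<beta> d) NT NS t s *\<^sub>v q"
    by (intro kernel_matrix_mult_add K1_images_far_split assms)
  have apply_P: "vec_index (re_apply (P1_west \<beta> d NT NS Nq1 w1 lam1 t s) q) l =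
      (\<Sum>j<NS. Re (\<Sum>n<Nq1. of_real (w1 n) * F1 \<beta> d (t l) (s j) (lam1 n)) * vec_index q j)" if "l < NT" for l
    using re_apply_index[OF P1_west_carrier assms(5) that] that by (simp add: P1_west_index)
  show "\<forall>l<NT.
      vec_index (re_apply (P1_west \<beta> d NT NS Nq1 w1 lam1 t s) q) l =
        (\<Sum>j<NS. Re (\<Sum>n<Nq1. of_real (w1 n) * F1 \<beta> d (t l) (s j) (lam1 n)) * vec_index q j) \<and>
      \<bar>vec_index (re_apply (P1_west \<beta> d NT NS Nq1 w1 lam1 t s) q) l
          - vec_index (kernel_matrix (K1_west \<beta> d) NT NS t s *\<^sub>v q) l\<bar>
        \<le> \<epsilon> * (\<Sum>j<NS. \<bar>vec_index q j\<bar>)"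
    using apply_P quadrature_error[OF quad K1_west_eq_integral[OF assms(1,2)] assms(5) _ s t] by simp
next
  assume le: "d \<ge> sqrt (\<xi>\<^sup>2 + \<eta>\<^sup>2)"
    and s: "s ` {..<NS} \<subseteq> cell2 d \<xi> \<eta>" and t: "t ` {..<NT} \<subseteq> cell2 d \<xi> \<eta>"
    and quad: "quadrature \<epsilon> (cell2 d \<xi> \<eta>) (F2 \<beta> d \<xi> \<eta>) Nq2 w2 lam2"
  show "west2 \<subseteq> far2" by (auto simp: west2_def far2_def)
  show "\<forall>l<NT. \<forall>j<NS. (\<lambda>(m, n). G \<beta> (t l) (s j + lattice d \<xi> \<eta> m n)) summable_on far2"
    using G_lattice_summable assms by blast
  show "kernel_matrix (K2_images far2 \<beta> d \<xi> \<eta>) NT NS t s *\<^sub>v q =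
      kernel_matrix (K2_west \<beta> d \<xi> \<eta>) NT NS t s *\<^sub>v q + kernel_matrix (K2_images (far2 - west2) \<beta> d \<xi> \<eta>) NT NS t s *\<^sub>v q"
    by (intro kernel_matrix_mult_add K2_images_far_split assms)
  have apply_P: "vec_index (re_apply (P2_west \<beta> d \<xi> \<eta> NT NS Nq2 w2 lam2 t s) q) l =
      (\<Sum>j<NS. Re (\<Sum>n<Nq2. of_real (w2 n) * F2 \<beta> d \<xi> \<eta> (t l) (s j) (lam2 n)) * vec_index q j)" if "l < NT" for l
    using re_apply_index[OF P2_west_carrier assms(5) that] that by (simp add: P2_west_index)
  show "\<forall>l<NT.
      vec_index (re_apply (P2_west \<beta> d \<xi> \<eta> NT NS Nq2 w2 lam2 t s) q) l =
        (\<Sum>j<NS. Re (\<Sum>n<Nq2. of_real (w2 n) * F2 \<beta> d \<xi> \<eta> (t l) (s j) (lam2 n)) * vec_index q j) \<and>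
      \<bar>vec_index (re_apply (P2_west \<beta> d \<xi> \<eta> NT NS Nq2 w2 lam2 t s) q) l
          - vec_index (kernel_matrix (K2_west \<beta> d \<xi> \<eta>) NT NS t s *\<^sub>v q) l\<bar>
        \<le> \<epsilon> * (\<Sum>j<NS. \<bar>vec_index q j\<bar>)"
    using apply_P quadrature_error[OF quad K2_west_eq_integral[OF assms(1-3) le] assms(5) _ s t] by simp
qed

end
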